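(* Let $W_J$ be the Weyl group of type $A_\infty$ with $J=\mathbb Z$, and let $\tilde w=s_{\mathfrak j_1}s_{\mathfrak j_2}s_{\mathfrak j_3}\cdots=w^{(0)}*w^{(1)}*w^{(2)}*\cdots$ be the infinite sequence of simple reflections with $w^{(t)}=s_{-t}s_{-t+1}\cdots s_{t-1}s_t\,s_{t+1}\,s_ts_{t-1}\cdots s_{-t+1}s_{-t}$ for $t\in\mathbb Z_{\ge0}$. Put $\tilde w_{\le p}=s_{\mathfrak j_1}\cdots s_{\mathfrak j_p}$ and $a(t)=t(2t+1)$ for $t\in\frac12\mathbb Z$. Then: (i) for $t\in\mathbb Z_{\ge0}$, $$\tilde w_{\le p-1}(\alpha_{\mathfrak j_p})=\begin{cases}\epsilon_{-t}-\epsilon_{t+2-p+a(t)}=\epsilon_{-t}-\epsilon_{1-t+a(t+1/2)-p}&\text{if }a(t)+1\le p\le a(t+\tfrac12),\\ \epsilon_{-t-1+p-a(t+1/2)}-\epsilon_{t+2}=\epsilon_{t+1+p-a(t+1)}-\epsilon_{t+2}&\text{if }a(t+\tfrac12)+1\le p\le a(t+1);\end{cases}$$ (ii) for any $p\in\mathbb Z_{\ge1}$, the expression $\tilde w_{\le p}=s_{\mathfrak j_1}\cdots s_{\mathfrak j_p}$ is reduced.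
   Context: $J=\mathbb Z$; $P_J=\bigoplus_{i\in J}\mathbb Z\Lambda_i$ with $(\Lambda_i,\Lambda_j)=-|i-j|/2$; $\epsilon_a=\Lambda_a-\Lambda_{a-1}$, so that $(\epsilon_a,\epsilon_b)=\delta_{a,b}$; the simple roots are $\alpha_j=\epsilon_j-\epsilon_{j+1}$. $W_J$ is generated by the simple reflections $s_j(\lambda)=\lambda-(\alpha_j,\lambda)\alpha_j$; thus $s_j(\epsilon_a)=\epsilon_{s_j(a)}$ where $s_j$ also denotes the transposition of $j$ and $j+1$ in $\mathbb Z$. $*$ denotes concatenation of sequences; $\tilde w_{\le0}$ is the identity. *)

theory Defs
  imports
    Complex_Main
    "HOL-Library.Poly_Mapping"
    "HOL-Library.Stream"
    "HOL-Algebra.Bij"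
    "HOL-Algebra.Elementary_Groups"
begin

section \<open>The weight lattice\<close>

text \<open>The lattice \<open>P_J\<close> for \<open>J = \<int>\<close> is the free abelian group on the
  \<open>\<Lambda>_i\<close>, \<open>i \<in> \<int>\<close>, that is, the type of finitely supported functions from
  the integers to the integers; \<open>frag_cmul\<close> is its scalar multiplication.\<close>

type_synonym weight = "int \<Rightarrow>\<^sub>0 int"

definition fund_weight :: "int \<Rightarrow> weight" where
  "fund_weight i = frag_of i"

text \<open>The bilinear extension of \<open>(\<Lambda>_i, \<Lambda>_j) = -|i - j|/2\<close>.\<close>

definition weight_form :: "weight \<Rightarrow> weight \<Rightarrow> rat" where
  "weight_form x y =
     (\<Sum>i\<in>Poly_Mapping.keys x. \<Sum>j\<in>Poly_Mapping.keys y.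
        of_int (Poly_Mapping.lookup x i) * of_int (Poly_Mapping.lookup y j)
          * (- of_int \<bar>i - j\<bar> / 2))"

definition eps :: "int \<Rightarrow> weight" where
  "eps a = fund_weight a - fund_weight (a - 1)"

definition simple_root :: "int \<Rightarrow> weight" where
  "simple_root j = eps j - eps (j + 1)"

text \<open>The form takes half-integral values, but the pairing of a simple root with
  an element of the lattice is an integer (lemma \<open>weight_form_simple_root\<close> below), so
  the floor only changes the type.\<close>

definition simple_reflection :: "int \<Rightarrow> weight \<Rightarrow> weight" where
  "simple_reflection j l = l - frag_cmul \<lfloor>weight_form (simple_root j) l\<rfloor> (simple_root j)"

lemma weight_form_fund_weight: "weight_form (fund_weight i) (fund_weight j) = - of_int \<bar>i - j\<bar> / 2"
  by (simp add: weight_form_def fund_weight_def)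

lemma weight_form_superset:
  assumes "finite A" "finite B" "Poly_Mapping.keys x \<subseteq> A" "Poly_Mapping.keys y \<subseteq> B"
  shows "weight_form x y =
     (\<Sum>i\<in>A. \<Sum>j\<in>B.
        of_int (Poly_Mapping.lookup x i) * of_int (Poly_Mapping.lookup y j)
          * (- of_int \<bar>i - j\<bar> / 2))"
proof -
  have inner: "(\<Sum>j\<in>Poly_Mapping.keys y.
        of_int (Poly_Mapping.lookup x i) * of_int (Poly_Mapping.lookup y j)
          * (- of_int \<bar>i - j\<bar> / 2 :: rat)) =
     (\<Sum>j\<in>B. of_int (Poly_Mapping.lookup x i) * of_int (Poly_Mapping.lookup y j)
          * (- of_int \<bar>i - j\<bar> / 2))" for i
    by (rule sum.mono_neutral_left) (use assms in \<open>auto simp: in_keys_iff\<close>)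
  show ?thesis
    unfolding weight_form_def inner
    by (rule sum.mono_neutral_left) (use assms in \<open>auto simp: in_keys_iff\<close>)
qed

lemma weight_form_commute: "weight_form x y = weight_form y x"
  unfolding weight_form_def by (subst sum.swap) (simp add: abs_minus_commute mult.commute)

lemma weight_form_diff_left: "weight_form (x - y) z = weight_form x z - weight_form y z"
proof -
  let ?A = "Poly_Mapping.keys x \<union> Poly_Mapping.keys y \<union> Poly_Mapping.keys (x - y)"
  let ?B = "Poly_Mapping.keys z"
  have "weight_form u z = (\<Sum>i\<in>?A. \<Sum>j\<in>?B.
        of_int (Poly_Mapping.lookup u i) * of_int (Poly_Mapping.lookup z j)
          * (- of_int \<bar>i - j\<bar> / 2))" if "Poly_Mapping.keys u \<subseteq> ?A" for u
    by (rule weight_form_superset) (use that in auto)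
  then have eqs: "weight_form u z = (\<Sum>i\<in>?A. \<Sum>j\<in>?B.
        of_int (Poly_Mapping.lookup u i) * of_int (Poly_Mapping.lookup z j)
          * (- of_int \<bar>i - j\<bar> / 2))" if "u = x \<or> u = y \<or> u = x - y" for u
    using that by blast
  show ?thesis
    unfolding eqs[of x, simplified] eqs[of y, simplified] eqs[of "x - y", simplified]
      sum_subtractf[symmetric]
    by (intro sum.cong) (auto simp: lookup_minus field_simps)
qed

lemma weight_form_diff_right: "weight_form z (x - y) = weight_form z x - weight_form z y"
  by (metis weight_form_commute weight_form_diff_left)

lemma weight_form_eps: "weight_form (eps a) (eps b) = (if a = b then 1 else 0)"
  by (auto simp: eps_def weight_form_diff_left weight_form_diff_right weight_form_fund_weight
        abs_if field_simps)

lemma weight_form_simple_root: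
  "weight_form (simple_root j) l = of_int (Poly_Mapping.lookup l j)"
proof -
  have coef: "weight_form (simple_root j) (fund_weight i) = (if i = j then 1 else 0)" for i
    unfolding simple_root_def eps_def weight_form_diff_left weight_form_fund_weight
    by (auto simp: abs_if field_simps)
  have expand: "weight_form x l =
      (\<Sum>i\<in>Poly_Mapping.keys l. of_int (Poly_Mapping.lookup l i) * weight_form x (fund_weight i))" for x
    unfolding weight_form_def fund_weight_def
    by (subst sum.swap) (simp add: sum_distrib_left mult.commute mult.left_commute)
  show ?thesis
    unfolding expand coef by (auto simp: in_keys_iff if_distrib sum.delta' cong: if_cong)
qed

lemma lookup_eps:
  "Poly_Mapping.lookup (eps a) k = (if k = a then 1 else 0) - (if k = a - 1 then 1 else 0)"
  by (simp add: eps_def fund_weight_def lookup_minus)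

lemma lookup_simple_root:
  "Poly_Mapping.lookup (simple_root j) k =
     (if k = j then 2 else 0) - (if k = j - 1 then 1 else 0) - (if k = j + 1 then 1 else 0)"
  by (simp add: simple_root_def lookup_minus lookup_eps)

lemma lookup_simple_reflection:
  "Poly_Mapping.lookup (simple_reflection j l) k =
     Poly_Mapping.lookup l k - Poly_Mapping.lookup l j * Poly_Mapping.lookup (simple_root j) k"
  by (simp add: simple_reflection_def weight_form_simple_root lookup_minus)

lemma simple_reflection_eps:
  "simple_reflection j (eps a) = eps (if a = j then j + 1 else if a = j + 1 then j else a)"
  by (rule poly_mapping_eqI)
     (auto simp: lookup_simple_reflection lookup_simple_root lookup_eps)

lemma simple_reflection_involution: "simple_reflection j (simple_reflection j l) = l"
  by (rule poly_mapping_eqI)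
     (simp add: lookup_simple_reflection lookup_simple_root algebra_simps)


section \<open>The Weyl group\<close>

definition weyl_group :: "(weight \<Rightarrow> weight) monoid" where
  "weyl_group = subgroup_generated (BijGroup UNIV) (range simple_reflection)"

definition weyl_word :: "int list \<Rightarrow> weight \<Rightarrow> weight" where
  "weyl_word js =
     foldr (\<lambda>j w. simple_reflection j \<otimes>\<^bsub>weyl_group\<^esub> w) js \<one>\<^bsub>weyl_group\<^esub>"

definition weyl_length :: "(weight \<Rightarrow> weight) \<Rightarrow> nat" where
  "weyl_length w = (LEAST n. \<exists>js. length js = n \<and> weyl_word js = w)"

definition reduced :: "int list \<Rightarrow> bool" where
  "reduced js \<longleftrightarrow> weyl_length (weyl_word js) = length js"

lemma bij_simple_reflection: "bij (simple_reflection j)"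
  by (rule o_bij[of "simple_reflection j"]) (auto simp: simple_reflection_involution)

lemma weyl_one: "\<one>\<^bsub>weyl_group\<^esub> = id"
  by (auto simp: weyl_group_def BijGroup_def)

lemma weyl_mult:
  assumes "bij f" "bij g"
  shows "f \<otimes>\<^bsub>weyl_group\<^esub> g = f \<circ> g"
  using assms by (auto simp: weyl_group_def BijGroup_def Bij_def compose_def)

lemma weyl_word_Nil [simp]: "weyl_word [] = id"
  by (simp add: weyl_word_def weyl_one)

lemma weyl_word_Cons_mult:
  "weyl_word (j # js) = simple_reflection j \<otimes>\<^bsub>weyl_group\<^esub> weyl_word js"
  by (simp add: weyl_word_def)

lemma bij_weyl_word: "bij (weyl_word js)"
proof (induction js)
  case Nil
  show ?case by (simp only: weyl_word_Nil bij_id)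
next
  case (Cons j js)
  then show ?case
    by (simp only: weyl_word_Cons_mult weyl_mult bij_simple_reflection bij_comp)
qed

lemma weyl_word_Cons [simp]: "weyl_word (j # js) = simple_reflection j \<circ> weyl_word js"
  by (simp only: weyl_word_Cons_mult weyl_mult bij_simple_reflection bij_weyl_word)

lemma weyl_word_append: "weyl_word (js @ ks) = weyl_word js \<circ> weyl_word ks"
  by (induction js) (auto simp: o_assoc)

text \<open>Since simple reflections are involutions, every element of the group is a
  product of simple reflections, so \<open>weyl_length\<close> is meaningful on all of it.\<close>

lemma carrier_weyl_group: "carrier weyl_group = range weyl_word"
proof -
  let ?B = "BijGroup (UNIV :: weight set)"
  interpret B: group ?B by (rule group_BijGroup)
  have sub: "range simple_reflection \<subseteq> carrier ?B"
    by (auto simp: BijGroup_def Bij_def bij_simple_reflection)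
  have car: "carrier weyl_group = generate ?B (range simple_reflection)"
    using sub by (simp add: weyl_group_def carrier_subgroup_generated Int_absorb1)
  have mult: "f \<otimes>\<^bsub>?B\<^esub> g = f \<circ> g" if "bij f" "bij g" for f g
    using that by (auto simp: BijGroup_def Bij_def compose_def)
  have one: "\<one>\<^bsub>?B\<^esub> = id" by (auto simp: BijGroup_def)
  have inv: "inv\<^bsub>?B\<^esub> (simple_reflection j) = simple_reflection j" for j
  proof (rule B.inv_equality)
    show "simple_reflection j \<otimes>\<^bsub>?B\<^esub> simple_reflection j = \<one>\<^bsub>?B\<^esub>"
      by (auto simp: mult one bij_simple_reflection simple_reflection_involution)
  qed (use sub in auto)
  have single: "simple_reflection j = weyl_word [j]" for j by simp
  have "w \<in> range weyl_word" if "w \<in> generate ?B (range simple_reflection)" for w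
    using that
  proof induction
    case one
    show ?case using \<open>\<one>\<^bsub>?B\<^esub> = id\<close> by (metis rangeI weyl_word_Nil)
  next
    case (incl h)
    then show ?case using single by blast
  next
    case (inv h)
    then show ?case using single \<open>\<And>j. inv\<^bsub>?B\<^esub> (simple_reflection j) = simple_reflection j\<close>
      by (metis imageE rangeI)
  next
    case (eng h1 h2)
    then show ?case
      by (auto simp: mult bij_weyl_word simp flip: weyl_word_append)
  qed
  moreover have "weyl_word js \<in> generate ?B (range simple_reflection)" for js
  proof (induction js)
    case Nil
    show ?case using generate.one[of ?B "range simple_reflection"] unfolding one weyl_word_Nil .
  next
    case (Cons j js)
    have "simple_reflection j \<otimes>\<^bsub>?B\<^esub> weyl_word js \<in> generate ?B (range simple_reflection)"
      by (intro generate.eng generate.incl Cons.IH) auto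
    then show ?case by (simp only: mult bij_simple_reflection bij_weyl_word weyl_word_Cons)
  qed
  ultimately show ?thesis using car by blast
qed


section \<open>The infinite word\<close>

text \<open>\<open>block t\<close> lists the indices of \<open>w^(t) = s_{-t} \<dots> s_t s_{t+1} s_t \<dots> s_{-t}\<close>.\<close>

definition block :: "nat \<Rightarrow> int list" where
  "block t = [- int t..int t] @ [int t + 1] @ rev [- int t..int t]"

definition w_seq :: "int stream" where
  "w_seq = flat (smap block nats)"

text \<open>The letters of the infinite word are numbered from 1, stream positions from 0.\<close>

definition letter :: "nat \<Rightarrow> int" where
  "letter p = w_seq !! (p - 1)"

definition w_expr :: "nat \<Rightarrow> int list" where
  "w_expr p = map letter [1..<p + 1]"

definition w_upto :: "nat \<Rightarrow> weight \<Rightarrow> weight" where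
  "w_upto p = weyl_word (w_expr p)"

text \<open>The function \<open>a(t) = t(2t + 1)\<close> is used on half-integers only, where it is
  integral (lemma \<open>a_fun_half_integer\<close>), so the floor only changes the type.\<close>

definition a_fun :: "rat \<Rightarrow> int" where
  "a_fun t = \<lfloor>t * (2 * t + 1)\<rfloor>"

lemma a_fun_half_integer:
  assumes "2 * t \<in> \<int>"
  shows "of_int (a_fun t) = t * (2 * t + 1)"
proof -
  from assms obtain n where n: "2 * t = of_int n" by (elim Ints_cases)
  have "even (n * (n + 1))" by simp
  then obtain k where k: "n * (n + 1) = 2 * k" by (elim evenE)
  have "2 * (t * (2 * t + 1)) = of_int (n * (n + 1))"
    by (simp add: n[symmetric] algebra_simps)
  then have "t * (2 * t + 1) = of_int k" unfolding k by simp
  then show ?thesis by (simp add: a_fun_def)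
qed

end

theory Submission
  imports Defs "HOL-Combinatorics.Transposition"
begin

text \<open>
  On the \<open>\<epsilon>\<close>'s a word in the simple reflections acts as a permutation \<open>w\<close> of the integers,
  and \<open>(w j, w (j + 1))\<close> is the pair of indices of the root \<open>w \<alpha>_j\<close>. Appending \<open>s_j\<close> to a word
  changes its set of inversions (recorded by values) by at most this one pair, and adds it
  whenever the root is positive. So a word all of whose roots are positive has as many inversions
  as letters, while no word has more inversions than letters; such a word is reduced.
  The roots themselves follow from the fact that \<open>w^(t)\<close> is the transposition of \<open>-t\<close> and \<open>t + 2\<close>,
  so that the first \<open>t\<close> blocks together reverse the interval from \<open>1 - t\<close> to \<open>t + 1\<close>.
\<close>

section \<open>The action on the integers\<close>

definition word_perm :: "int list \<Rightarrow> int \<Rightarrow> int" where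
  "word_perm js = foldr (\<lambda>j w. transpose j (j + 1) \<circ> w) js id"

lemma word_perm_Nil [simp]: "word_perm [] = id"
  by (simp add: word_perm_def)

lemma word_perm_Cons [simp]: "word_perm (j # js) = transpose j (j + 1) \<circ> word_perm js"
  by (simp add: word_perm_def)

lemma word_perm_append [simp]: "word_perm (js @ ks) = word_perm js \<circ> word_perm ks"
  by (induction js) (auto simp: o_assoc)

lemma inj_word_perm: "inj (word_perm js)"
proof (induction js)
  case (Cons j js)
  then show ?case
    by (simp only: word_perm_Cons inj_compose inj_transpose)
qed (simp only: word_perm_Nil inj_on_id)

lemma weyl_word_eps: "weyl_word js (eps a) = eps (word_perm js a)"
  by (induction js) (auto simp: simple_reflection_eps transpose_def)

lemma simple_reflection_diff:
  "simple_reflection j (x - y) = simple_reflection j x - simple_reflection j y"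
  by (rule poly_mapping_eqI) (simp add: lookup_simple_reflection lookup_minus algebra_simps)

lemma weyl_word_diff: "weyl_word js (x - y) = weyl_word js x - weyl_word js y"
  by (induction js) (auto simp: simple_reflection_diff)

lemma weyl_word_simple_root:
  "weyl_word js (simple_root j) = eps (word_perm js j) - eps (word_perm js (j + 1))"
  by (simp add: simple_root_def weyl_word_diff weyl_word_eps)

lemma eps_inject: "eps a = eps b \<longleftrightarrow> a = b"
proof
  assume "eps a = eps b"
  then have "Poly_Mapping.lookup (eps a) a = Poly_Mapping.lookup (eps b) a"
    by simp
  then show "a = b"
    by (simp add: lookup_eps split: if_splits)
qed simp

text \<open>Since \<open>eps\<close> is injective, the permutation depends only on the group
  element, so inversion counts can be compared between different words for it.\<close>

lemma word_perm_eqI: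
  assumes "weyl_word js = weyl_word ks"
  shows "word_perm js = word_perm ks"
  by (rule ext) (metis assms weyl_word_eps eps_inject)


section \<open>Inversions\<close>

text \<open>Values rather than positions are recorded because multiplying by \<open>s_j\<close> on
  the right permutes positions only: all other inversions then stay literally the same
  pairs.\<close>

definition inversions :: "(int \<Rightarrow> int) \<Rightarrow> (int \<times> int) set" where
  "inversions w = {(w c, w d) | c d. d < c \<and> w c < w d}"

lemma inversionsI: "d < c \<Longrightarrow> w c < w d \<Longrightarrow> (w c, w d) \<in> inversions w"
  unfolding inversions_def by blast

text \<open>An adjacent transposition preserves the order of every pair of positions other than
  \<open>j\<close>, \<open>j + 1\<close>.\<close>

lemma inversions_transpose_subset:
  "inversions (w \<circ> transpose j (j + 1)) \<subseteq> insert (w j, w (j + 1)) (inversions w)"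
proof clarify
  fix x y
  assume xy: "(x, y) \<in> inversions (w \<circ> transpose j (j + 1))"
    and new: "(x, y) \<notin> inversions w"
  obtain c d where "d < c" and x: "x = w (transpose j (j + 1) c)"
    and y: "y = w (transpose j (j + 1) d)" and "x < y"
    using xy by (auto simp: inversions_def)
  then have "\<not> transpose j (j + 1) d < transpose j (j + 1) c"
    using new by (auto simp: inversions_def)
  with \<open>d < c\<close> have "d = j" "c = j + 1"
    by (auto simp: transpose_def split: if_splits)
  then show "x = w j \<and> y = w (j + 1)"
    by (simp add: x y)
qed

lemma inversions_transpose_increasing:
  assumes "inj w" "w j < w (j + 1)"
  shows "inversions (w \<circ> transpose j (j + 1)) = insert (w j, w (j + 1)) (inversions w)"
    and "(w j, w (j + 1)) \<notin> inversions w"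
proof -
  let ?s = "transpose j (j + 1)"
  \<comment> \<open>By injectivity these values occur only at \<open>j\<close> and
    \<open>j + 1\<close>, so being an inversion would require \<open>j + 1 < j\<close>.\<close>
  show "(w j, w (j + 1)) \<notin> inversions w"
    using assms(1) by (auto simp: inversions_def inj_eq)
  have "(w j, w (j + 1)) \<in> inversions (w \<circ> ?s)"
    using assms(2) inversionsI[of j "j + 1" "w \<circ> ?s"] by simp
  moreover have "(w c, w d) \<in> inversions (w \<circ> ?s)" if "d < c" "w c < w d" for c d
  proof -
    \<comment> \<open>The only pair of positions whose order \<open>?s\<close> reverses is no
      inversion of \<open>w\<close>, so every inversion survives at the positions
      \<open>?s d\<close>, \<open>?s c\<close>.\<close>
    have "\<not> (d = j \<and> c = j + 1)"
      using that assms(2) by auto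
    then have "?s d < ?s c"
      using \<open>d < c\<close> by (auto simp: transpose_def)
    then show ?thesis
      using \<open>w c < w d\<close> inversionsI[of "?s d" "?s c" "w \<circ> ?s"] by simp
  qed
  then have "inversions w \<subseteq> inversions (w \<circ> ?s)"
    unfolding inversions_def[of w] by blast
  ultimately show "inversions (w \<circ> ?s) = insert (w j, w (j + 1)) (inversions w)"
    using inversions_transpose_subset by blast
qed

lemma inversions_id [simp]: "inversions id = {}"
  by (auto simp: inversions_def)

lemma finite_inversions: "finite (inversions (word_perm js))"
  and card_inversions_le: "card (inversions (word_perm js)) \<le> length js"
proof (induction js rule: rev_induct)
  case (snoc j js)
  let ?I = "insert (word_perm js j, word_perm js (j + 1)) (inversions (word_perm js))"
  have sub: "inversions (word_perm (js @ [j])) \<subseteq> ?I"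
    using inversions_transpose_subset[of "word_perm js" j] by simp
  {
    case 1
    show ?case using sub snoc(1) by (meson finite.insertI finite_subset)
  next
    case 2
    have "card (inversions (word_perm (js @ [j]))) \<le> card ?I"
      using sub snoc(1) by (meson card_mono finite.insertI)
    also have "\<dots> \<le> Suc (card (inversions (word_perm js)))"
      by (simp add: card_insert_le_m1 snoc(1) card_insert_if)
    finally show ?case using snoc(2) by (simp add: comp_def)
  }
qed simp_all

lemma card_inversions_eq:
  assumes "\<And>n. n < length js \<Longrightarrow>
    word_perm (take n js) (js ! n) < word_perm (take n js) (js ! n + 1)"
  shows "card (inversions (word_perm js)) = length js"
  using assms
proof (induction js rule: rev_induct)
  case (snoc j js)
  have "word_perm js j < word_perm js (j + 1)"
    using snoc.prems[of "length js"] by simp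
  note step = inversions_transpose_increasing[OF inj_word_perm this]
  have "card (inversions (word_perm js)) = length js"
  proof (rule snoc.IH)
    fix n
    assume "n < length js"
    then show "word_perm (take n js) (js ! n) < word_perm (take n js) (js ! n + 1)"
      using snoc.prems[of n] by (simp add: nth_append)
  qed
  then show ?case
    using step by (simp add: finite_inversions comp_def)
qed simp

lemma reducedI:
  assumes "\<And>n. n < length js \<Longrightarrow>
    word_perm (take n js) (js ! n) < word_perm (take n js) (js ! n + 1)"
  shows "reduced js"
  unfolding reduced_def weyl_length_def
proof (rule Least_equality)
  show "\<exists>ks. length ks = length js \<and> weyl_word ks = weyl_word js"
    by blast
next
  fix n
  assume "\<exists>ks. length ks = n \<and> weyl_word ks = weyl_word js"
  then obtain ks where "length ks = n" "word_perm ks = word_perm js"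
    using word_perm_eqI by blast
  then show "length js \<le> n"
    using card_inversions_le[of ks] card_inversions_eq[OF assms] by simp
qed


section \<open>The blocks\<close>

lemma take_upto: "int k \<le> j - i + 1 \<Longrightarrow> take k [i..j] = [i..i + int k - 1]"
  by (rule nth_equalityI) (auto simp: nth_upto)

lemma take_rev_upto: "int k \<le> j - i + 1 \<Longrightarrow> take k (rev [i..j]) = rev [j + 1 - int k..j]"
  by (rule nth_equalityI) (auto simp: nth_upto rev_nth)

text \<open>The ascending product is the cycle l -> l+1 -> ... -> u+1 -> l, and the reversed word
  below gives its inverse. The hypothesis admits the empty word, \<open>u = l - 1\<close>, where the
  induction starts.\<close>

lemma word_perm_upto:
  assumes "l \<le> u + 1"
  shows "word_perm [l..u] a = (if l \<le> a \<and> a \<le> u then a + 1 else if a = u + 1 then l else a)"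
proof -
  have "l - 1 \<le> u" using assms by simp
  then show ?thesis
  proof (induction u arbitrary: a rule: int_ge_induct)
    case (step u)
    then have "[l..u + 1] = [l..u] @ [u + 1]"
      by (simp add: upto_rec2)
    then show ?case
      using \<open>l - 1 \<le> u\<close> by (auto simp: step.IH transpose_def)
  qed simp
qed

lemma word_perm_rev_upto:
  assumes "l \<le> u + 1"
  shows "word_perm (rev [l..u]) a =
    (if l < a \<and> a \<le> u + 1 then a - 1 else if a = l then u + 1 else a)"
proof -
  have "l - 1 \<le> u" using assms by simp
  then show ?thesis
  proof (induction u arbitrary: a rule: int_ge_induct)
    case (step u)
    then have "[l..u + 1] = [l..u] @ [u + 1]"
      by (simp add: upto_rec2)
    then show ?case
      using \<open>l - 1 \<le> u\<close> by (auto simp: step.IH transpose_def)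
  qed simp
qed

text \<open>Moving the peak letter \<open>t + 1\<close> into the descending run leaves just two
  cycles to compose.\<close>

lemma block_eq: "block t = [- int t..int t] @ rev [- int t..int t + 1]"
  by (simp add: block_def upto_rec2)

lemma length_block: "length (block t) = 4 * t + 3"
  by (simp add: block_def)

text \<open>The block is a palindrome: it conjugates \<open>s_{t+1}\<close> by the ascending
  product, which sends \<open>t + 1\<close> to \<open>-t\<close> and fixes
  \<open>t + 2\<close>.\<close>

lemma word_perm_block: "word_perm (block t) = transpose (- int t) (int t + 2)"
proof
  fix a
  consider "a < - int t \<or> int t + 2 < a" | "a = - int t" | "a = int t + 2"
    | "- int t < a" "a \<le> int t + 1"
    by linarith
  then show "word_perm (block t) a = transpose (- int t) (int t + 2) a"
    by cases (auto simp: block_eq word_perm_upto word_perm_rev_upto transpose_def)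
qed

section \<open>Prefixes of the infinite word\<close>

definition blocks :: "nat \<Rightarrow> int list" where
  "blocks t = concat (map block [0..<t])"

lemma length_blocks: "length (blocks t) = t * (2 * t + 1)"
  by (induction t) (auto simp: blocks_def length_block algebra_simps)

text \<open>The transpositions of \<open>-i\<close> and \<open>i + 2\<close> for
  \<open>i < t\<close> are disjoint and all symmetric about 1, hence together form a reflection in
  1.\<close>

lemma word_perm_blocks:
  "word_perm (blocks t) a = (if 1 - int t \<le> a \<and> a \<le> int t + 1 then 2 - a else a)"
proof (induction t arbitrary: a)
  case 0
  then show ?case by (simp add: blocks_def)
next
  case (Suc t)
  have "word_perm (blocks (Suc t)) a = word_perm (blocks t) (transpose (- int t) (int t + 2) a)"
    by (simp add: blocks_def word_perm_block)
  then show ?case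
    unfolding Suc.IH transpose_def by auto
qed

lemma w_seq_eq: "w_seq = blocks t @- (block t @- flat (smap block (fromN (Suc t))))"
proof -
  \<comment> \<open>Unfolding \<open>block_def\<close> shows the block to be nonempty, which lets
    \<open>flat\<close> release it as a prefix.\<close>
  have step: "flat (smap block (fromN n)) = block n @- flat (smap block (fromN (Suc n)))" for n
    by (subst siterate.code, simp) (simp add: flat_Cons block_def)
  have "w_seq = blocks t @- flat (smap block (fromN t))"
  proof (induction t)
    case 0
    then show ?case by (simp add: w_seq_def blocks_def)
  next
    case (Suc t)
    then show ?case by (subst Suc, subst step) (simp add: blocks_def)
  qed
  then show ?thesis
    by (simp only: step[of t])
qed

lemma w_expr_eq_stake: "w_expr p = stake p w_seq"
  by (rule nth_equalityI) (auto simp: w_expr_def letter_def simp del: upt_Suc)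

lemma w_expr_blocks:
  assumes "k \<le> 4 * t + 3"
  shows "w_expr (length (blocks t) + k) = blocks t @ take k (block t)"
  unfolding w_expr_eq_stake w_seq_eq[of t]
  using assms by (simp add: stake_shift length_block)

lemma letter_blocks:
  assumes "k < 4 * t + 3"
  shows "letter (Suc (length (blocks t) + k)) = block t ! k"
  unfolding letter_def w_seq_eq[of t]
  using assms by (simp add: length_block)

section \<open>The roots, with \<open>n\<close> in the role of p - 1\<close>

lemma root_first_half:
  assumes "k < 2 * t + 1"
  defines "n \<equiv> length (blocks t) + k"
  shows "word_perm (w_expr n) (letter (Suc n)) = - int t"
    and "word_perm (w_expr n) (letter (Suc n) + 1) = int t + 1 - int k"
proof -
  have letter: "letter (Suc n) = - int t + int k"
    unfolding n_def using assms(1)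
    by (subst letter_blocks) (auto simp: block_eq nth_append nth_upto)
  have expr: "w_expr n = blocks t @ [- int t..- int t + int k - 1]"
    unfolding n_def using assms(1)
    by (subst w_expr_blocks) (simp_all add: block_eq take_upto)
  \<comment> \<open>The partial ascending run sends \<open>-t + k\<close> to \<open>-t\<close>,
    which the earlier blocks fix; it fixes \<open>-t + k + 1\<close>, which they reflect to
    \<open>t + 1 - k\<close>.\<close>
  show "word_perm (w_expr n) (letter (Suc n)) = - int t"
    "word_perm (w_expr n) (letter (Suc n) + 1) = int t + 1 - int k"
    unfolding letter expr using assms(1)
    by (simp_all add: word_perm_blocks word_perm_upto)
qed

lemma root_second_half:
  assumes "m \<le> 2 * t + 1"
  defines "n \<equiv> length (blocks t) + (2 * t + 1 + m)"
  shows "word_perm (w_expr n) (letter (Suc n)) = int m - int t"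
    and "word_perm (w_expr n) (letter (Suc n) + 1) = int t + 2"
proof -
  have letter: "letter (Suc n) = int t + 1 - int m"
    unfolding n_def using assms(1)
    by (subst letter_blocks) (auto simp: block_eq nth_append nth_upto rev_nth)
  have "take m (rev [- int t..int t + 1]) = rev [int t + 2 - int m..int t + 1]"
    using assms(1) take_rev_upto[of m "int t + 1" "- int t"] by (simp add: add.commute)
  \<comment> \<open>The \<open>nat\<close> term is the length of the ascending half in the form the
    simplifier produces for \<open>take\<close> of an append.\<close>
  moreover have "2 * t + 1 + m - nat (2 * int t + 1) = m"
    by linarith
  ultimately have expr: "w_expr n = blocks t @ [- int t..int t] @ rev [int t + 2 - int m..int t + 1]"
    unfolding n_def using assms(1)
    by (subst w_expr_blocks) (simp_all add: block_eq)
  \<comment> \<open>The descending run sends \<open>t + 2 - m\<close> to \<open>t + 2\<close>, fixed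
    by all else. It fixes \<open>t + 1 - m\<close>, which the ascent moves to
    \<open>t + 2 - m\<close> and the reflection to \<open>m - t\<close>; at the peak,
    \<open>m = 0\<close>, the ascent instead gives \<open>-t\<close> directly.\<close>
  show "word_perm (w_expr n) (letter (Suc n)) = int m - int t"
    "word_perm (w_expr n) (letter (Suc n) + 1) = int t + 2"
    unfolding letter expr using assms(1)
    by (simp_all add: word_perm_blocks word_perm_upto word_perm_rev_upto)
qed

lemma block_position_cases:
  obtains (first) t k where "k < 2 * t + 1" "n = length (blocks t) + k"
    | (second) t m where "m \<le> 2 * t + 1" "n = length (blocks t) + (2 * t + 1 + m)"
proof -
  have "\<exists>t k. k < 4 * t + 3 \<and> n = length (blocks t) + k"
  proof (induction n)
    case 0
    show ?case by (rule exI[of _ 0], rule exI[of _ 0]) (simp add: blocks_def)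
  next
    case (Suc n)
    then obtain t k where tk: "k < 4 * t + 3" "n = length (blocks t) + k"
      by blast
    show ?case
    proof (cases "Suc k < 4 * t + 3")
      case True
      with tk show ?thesis by (metis add_Suc_right)
    next
      case False
      \<comment> \<open>Block \<open>t\<close> is exhausted, so the next position opens block
        \<open>t + 1\<close>.\<close>
      with tk have "Suc n = length (blocks (Suc t)) + 0"
        by (simp add: blocks_def length_block)
      then show ?thesis by (metis add_gr_0 zero_less_numeral)
    qed
  qed
  then obtain t k where tk: "k < 4 * t + 3" "n = length (blocks t) + k"
    by blast
  show thesis
  proof (cases "k < 2 * t + 1")
    case True
    then show ?thesis using tk first by blast
  next
    case False
    then obtain m where "k = 2 * t + 1 + m" by (metis le_Suc_ex not_less)
    then show ?thesis using tk second[of m t] by simp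
  qed
qed

text \<open>The bounds on \<open>k\<close> and \<open>m\<close> give \<open>-t < t + 1 - k\<close>
  and \<open>m - t < t + 2\<close>.\<close>

lemma root_positive:
  "word_perm (w_expr n) (letter (Suc n)) < word_perm (w_expr n) (letter (Suc n) + 1)"
proof (cases n rule: block_position_cases)
  case (first t k)
  then show ?thesis using root_first_half[of k t] by simp
next
  case (second t m)
  then show ?thesis using root_second_half[of m t] by simp
qed

lemma reduced_w_expr: "reduced (w_expr p)"
proof (rule reducedI)
  fix n
  assume "n < length (w_expr p)"
  then have "take n (w_expr p) = w_expr n" "w_expr p ! n = letter (Suc n)"
    by (simp_all add: w_expr_def take_map take_upt del: upt_Suc)
  then show "word_perm (take n (w_expr p)) (w_expr p ! n)
      < word_perm (take n (w_expr p)) (w_expr p ! n + 1)"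
    using root_positive by simp
qed

text \<open>The three values mark the start of block \<open>t\<close>, the end of its ascending half
  and its end, so the two ranges of \<open>p\<close> are the ascent and the peak with the
  descent.\<close>

lemma a_fun_nat: "a_fun (of_nat t) = int (length (blocks t))"
  and a_fun_nat_half: "a_fun (of_nat t + 1/2) = int (length (blocks t) + (2 * t + 1))"
  and a_fun_nat_Suc: "a_fun (of_nat t + 1) = int (length (blocks t) + (4 * t + 3))"
proof -
  have floor: "a_fun x = int n" if "x * (2 * x + 1) = of_nat n" for x n
    unfolding a_fun_def that by simp
  show "a_fun (of_nat t) = int (length (blocks t))"
    "a_fun (of_nat t + 1/2) = int (length (blocks t) + (2 * t + 1))"
    "a_fun (of_nat t + 1) = int (length (blocks t) + (4 * t + 3))"
    unfolding length_blocks by (rule floor; simp add: field_simps)+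
qed

theorem proposition4p1:
  shows
    "(\<forall>(t::nat) (p::nat).
        (a_fun (of_nat t) + 1 \<le> int p \<and> int p \<le> a_fun (of_nat t + 1/2) \<longrightarrow>
           w_upto (p - 1) (simple_root (letter p))
             = eps (- int t) - eps (int t + 2 - int p + a_fun (of_nat t)) \<and>
           eps (- int t) - eps (int t + 2 - int p + a_fun (of_nat t))
             = eps (- int t) - eps (1 - int t + a_fun (of_nat t + 1/2) - int p)) \<and>
        (a_fun (of_nat t + 1/2) + 1 \<le> int p \<and> int p \<le> a_fun (of_nat t + 1) \<longrightarrow>
           w_upto (p - 1) (simple_root (letter p))
             = eps (- int t - 1 + int p - a_fun (of_nat t + 1/2)) - eps (int t + 2) \<and>
           eps (- int t - 1 + int p - a_fun (of_nat t + 1/2)) - eps (int t + 2)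
             = eps (int t + 1 + int p - a_fun (of_nat t + 1)) - eps (int t + 2)))
     \<and> (\<forall>p\<ge>1. reduced (w_expr p))"
proof (intro conjI allI impI)
  fix t p :: nat
  assume "a_fun (of_nat t) + 1 \<le> int p \<and> int p \<le> a_fun (of_nat t + 1/2)"
  then have "length (blocks t) + 1 \<le> p" "p \<le> length (blocks t) + (2 * t + 1)"
    unfolding a_fun_nat a_fun_nat_half by linarith+
  \<comment> \<open>\<open>k\<close> counts the letters of block \<open>t\<close> before letter
    \<open>p\<close>; in the second range \<open>m\<close> counts those from the peak on.\<close>
  moreover from this(1) obtain k where "p = length (blocks t) + 1 + k"
    using le_Suc_ex by blast
  ultimately have k: "k < 2 * t + 1" and p: "p = Suc (length (blocks t) + k)"
    by linarith+
  show "w_upto (p - 1) (simple_root (letter p))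
      = eps (- int t) - eps (int t + 2 - int p + a_fun (of_nat t))"
    unfolding p w_upto_def weyl_word_simple_root a_fun_nat diff_Suc_1
      root_first_half[OF k] by (simp add: algebra_simps)
  show "eps (- int t) - eps (int t + 2 - int p + a_fun (of_nat t))
      = eps (- int t) - eps (1 - int t + a_fun (of_nat t + 1/2) - int p)"
    unfolding a_fun_nat a_fun_nat_half by (simp add: algebra_simps)
next
  fix t p :: nat
  assume "a_fun (of_nat t + 1/2) + 1 \<le> int p \<and> int p \<le> a_fun (of_nat t + 1)"
  then have "length (blocks t) + (2 * t + 1) + 1 \<le> p" "p \<le> length (blocks t) + (4 * t + 3)"
    unfolding a_fun_nat_Suc a_fun_nat_half by linarith+
  moreover from this(1) obtain m where "p = length (blocks t) + (2 * t + 1) + 1 + m"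
    using le_Suc_ex by blast
  ultimately have m: "m \<le> 2 * t + 1" and p: "p = Suc (length (blocks t) + (2 * t + 1 + m))"
    by linarith+
  show "w_upto (p - 1) (simple_root (letter p))
      = eps (- int t - 1 + int p - a_fun (of_nat t + 1/2)) - eps (int t + 2)"
    unfolding p w_upto_def weyl_word_simple_root a_fun_nat_half diff_Suc_1
      root_second_half[OF m] by (simp add: algebra_simps)
  show "eps (- int t - 1 + int p - a_fun (of_nat t + 1/2)) - eps (int t + 2)
      = eps (int t + 1 + int p - a_fun (of_nat t + 1)) - eps (int t + 2)"
    unfolding a_fun_nat_Suc a_fun_nat_half by (simp add: algebra_simps)
next
  fix p :: nat
  show "reduced (w_expr p)"
    by (rule reduced_w_expr)
qed

end
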